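(* The cross polytope $C_n=\operatorname{conv}(\pm e_i: 1\le i\le n)\subseteq\mathbb{R}^n$ fulfills the rhombus criterion.
   Context: $e_1,\dots,e_n$ is the standard basis of $\mathbb{R}^n$. A polytope $P$ with vertex set $V$ fulfills the rhombus criterion if for every pair of distinct vertices $\alpha,\beta\in V$, either $\operatorname{conv}(\alpha,\beta)$ is an edge (1-dimensional face) of $P$, or there exist $\alpha',\beta'\in V\setminus\{\alpha,\beta\}$ with $\alpha+\beta=\alpha'+\beta'$. *)

theory Defs
  imports "HOL-Analysis.Analysis"
begin

definition vertices :: "'a::euclidean_space set \<Rightarrow> 'a set" where
  "vertices P = {v. v extreme_point_of P}"

text \<open>
  Faces in the sense of \<^const>\<open>face_of\<close> include the polytope itself, so a segment is an edge of itself.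
  The points \<open>\<alpha>'\<close> and \<open>\<beta>'\<close> are not required to be distinct.
\<close>

definition rhombus_criterion :: "'a::euclidean_space set \<Rightarrow> bool" where
  "rhombus_criterion P \<longleftrightarrow>
     polytope P \<and>
     (\<forall>\<alpha>\<in>vertices P. \<forall>\<beta>\<in>vertices P. \<alpha> \<noteq> \<beta> \<longrightarrow>
        (convex hull {\<alpha>, \<beta>}) edge_of P \<or>
        (\<exists>\<alpha>'\<in>vertices P - {\<alpha>, \<beta>}. \<exists>\<beta>'\<in>vertices P - {\<alpha>, \<beta>}. \<alpha> + \<beta> = \<alpha>' + \<beta>'))"

definition cross_polytope :: "(real ^ 'n) set" where
  "cross_polytope = convex hull ((\<Union>i. {axis i 1, - axis i 1}))"

end

theory Submission
  imports Defs
begin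

text \<open>
  Two vertices that are neither equal nor opposite are orthogonal unit vectors, and the functional
  \<open>x \<mapsto> (\<alpha> + \<beta>) \<bullet> x\<close> attains its maximum over the vertices exactly at \<open>\<alpha>\<close> and \<open>\<beta>\<close>, so they span an
  edge. Opposite vertices sum to \<open>0\<close>, as does any other opposite pair; if there is none, the polytope
  is itself the segment between them.
\<close>

text \<open>The affine hull of the points attaining the bound \<open>b\<close> stays in the
  hyperplane, while the convex hull of the others lies strictly below it. This disjointness is what
  \<open>face_of_convex_hulls\<close> asks for.\<close>

lemma convex_hull_hyperplane_face_of:
  fixes S :: "'a::euclidean_space set"
  assumes "finite S" and le: "\<And>x. x \<in> S \<Longrightarrow> a \<bullet> x \<le> b"
  shows "convex hull {x \<in> S. a \<bullet> x = b} face_of convex hull S"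
proof (rule face_of_convex_hulls)
  have "affine hull {x \<in> S. a \<bullet> x = b} \<subseteq> {x. a \<bullet> x = b}"
    by (rule hull_minimal) (auto simp: affine_hyperplane)
  moreover have "convex hull (S - {x \<in> S. a \<bullet> x = b}) \<subseteq> {x. a \<bullet> x < b}"
    using le by (intro hull_minimal convex_halfspace_lt) (auto simp: less_le)
  ultimately show "affine hull {x \<in> S. a \<bullet> x = b} \<inter> convex hull (S - {x \<in> S. a \<bullet> x = b}) = {}"
    by fastforce
qed (use \<open>finite S\<close> in auto)

text \<open>Coordinate-free form of the generators, so that the argument runs in any Euclidean
  space.\<close>

definition signed_Basis :: "'a::euclidean_space set" where
  "signed_Basis = Basis \<union> uminus ` Basis"

lemma finite_signed_Basis: "finite signed_Basis"
  by (simp add: signed_Basis_def)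

lemma uminus_in_signed_Basis: "x \<in> signed_Basis \<Longrightarrow> - x \<in> signed_Basis"
  by (auto simp: signed_Basis_def)

lemma cross_polytope_eq: "cross_polytope = convex hull (signed_Basis :: (real ^ 'n) set)"
  unfolding cross_polytope_def signed_Basis_def
  by (rule arg_cong[where f = "\<lambda>S. convex hull S"]) (auto simp: Basis_vec_def)

lemma nonzero_signed_Basis: "x \<in> signed_Basis \<Longrightarrow> x \<noteq> 0"
  by (auto simp: signed_Basis_def)

lemma inner_signed_Basis:
  fixes x y :: "'a::euclidean_space"
  assumes "x \<in> signed_Basis" "y \<in> signed_Basis"
  shows "x \<bullet> y = (if x = y then 1 else if x = - y then -1 else 0)"
proof -
  \<comment> \<open>The cases \<open>x = y\<close> and \<open>x = - y\<close> must exclude each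
    other, and two members of \<open>Basis\<close> must never be opposite, since their inner product
    is 0 or 1.\<close>
  have "x \<noteq> - x"
    using nonzero_signed_Basis[OF assms(1)] by (simp add: eq_neg_iff_add_eq_0 flip: scaleR_2)
  moreover have "x \<noteq> - y" if "x \<in> Basis" "y \<in> Basis" for x y :: 'a
  proof
    assume "x = - y"
    with that have "x \<bullet> y = -1" by simp
    with that show False by (simp add: inner_Basis split: if_splits)
  qed
  ultimately show ?thesis
    using assms by (fastforce simp: signed_Basis_def inner_Basis minus_equation_iff)
qed

text \<open>A generator \<open>x\<close> is the only one at which the functional
  \<open>x \<bullet> y\<close> reaches its maximum 1, so \<open>{x}\<close> is a face.\<close>

lemma vertices_convex_hull_signed_Basis: "vertices (convex hull signed_Basis) = signed_Basis"
proof (intro equalityI subsetI)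
  fix x :: 'a
  assume "x \<in> vertices (convex hull signed_Basis)"
  then show "x \<in> signed_Basis"
    by (simp add: vertices_def extreme_point_of_convex_hull)
next
  fix x :: 'a
  assume x: "x \<in> signed_Basis"
  have "convex hull {y \<in> signed_Basis. x \<bullet> y = 1} face_of convex hull signed_Basis"
    using x by (intro convex_hull_hyperplane_face_of)
      (simp_all add: finite_signed_Basis inner_signed_Basis)
  also have "{y \<in> signed_Basis. x \<bullet> y = 1} = {x}"
    using x by (auto simp: inner_signed_Basis split: if_splits)
  finally show "x \<in> vertices (convex hull signed_Basis)"
    by (simp add: vertices_def face_of_singleton)
qed

lemma signed_Basis_segment_face_of:
  assumes x: "x \<in> signed_Basis" and y: "y \<in> signed_Basis" and "x \<noteq> y" "x \<noteq> - y"
  shows "convex hull {x, y} face_of convex hull signed_Basis"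
proof -
  \<comment> \<open>As \<open>x\<close> and \<open>y\<close> are neither equal nor opposite, at most
    one of the two summands is nonzero.\<close>
  have inner: "(x + y) \<bullet> z = (if z = x \<or> z = y then 1 else if z = - x \<or> z = - y then -1 else 0)"
    if z: "z \<in> signed_Basis" for z
    using assms nonzero_signed_Basis[OF x] nonzero_signed_Basis[OF y]
    by (auto simp: inner_add_left inner_signed_Basis[OF x z] inner_signed_Basis[OF y z]
        minus_equation_iff)
  have "convex hull {z \<in> signed_Basis. (x + y) \<bullet> z = 1} face_of convex hull signed_Basis"
    by (rule convex_hull_hyperplane_face_of) (simp_all add: finite_signed_Basis inner)
  also have "{z \<in> signed_Basis. (x + y) \<bullet> z = 1} = {x, y}"
    using x y by (auto simp: inner split: if_splits)
  finally show ?thesis .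
qed

lemma rhombus_criterion_signed_Basis: "rhombus_criterion (convex hull signed_Basis)"
  unfolding rhombus_criterion_def vertices_convex_hull_signed_Basis
proof (intro conjI ballI impI)
  show "polytope (convex hull signed_Basis)"
    using finite_signed_Basis by (auto simp: polytope_def)
next
  fix x y :: 'a
  assume x: "x \<in> signed_Basis" and y: "y \<in> signed_Basis" and "x \<noteq> y"
  have edge: "convex hull {x, y} edge_of convex hull signed_Basis"
    if "convex hull {x, y} face_of convex hull signed_Basis"
    using that \<open>x \<noteq> y\<close> by (simp add: edge_of_def aff_dim_convex_hull aff_dim_2)
  \<comment> \<open>The second case is dimension one, where no other opposite pair exists.\<close>
  consider "x \<noteq> - y" | "signed_Basis = {x, y}" | z where "x = - y" "z \<in> signed_Basis - {x, y}"
    using x y by blast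
  then show "convex hull {x, y} edge_of convex hull signed_Basis \<or>
    (\<exists>x'\<in>signed_Basis - {x, y}. \<exists>y'\<in>signed_Basis - {x, y}. x + y = x' + y')"
  proof cases
    case 1
    then show ?thesis
      using edge signed_Basis_segment_face_of[OF x y \<open>x \<noteq> y\<close>] by blast
  next
    case 2
    then show ?thesis
      using edge by (simp add: face_of_refl)
  next
    case 3
    \<comment> \<open>Negation swaps \<open>x\<close> and \<open>y\<close>, hence preserves the
      complement of \<open>{x, y}\<close>.\<close>
    then have "- z \<in> signed_Basis - {x, y}"
      by (auto simp: uminus_in_signed_Basis)
    with 3 show ?thesis
      by (intro disjI2 bexI[of _ z] bexI[of _ "- z"]) auto
  qed
qed

theorem proposition4p1:
  shows "rhombus_criterion (cross_polytope :: (real ^ 'n) set)"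
  unfolding cross_polytope_eq by (rule rhombus_criterion_signed_Basis)

end
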